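(* Let $n$ be a positive integer, let $h_1,\ldots,h_n$ be non-negative integers with sum $H:=h_1+\ldots+h_n$, let $K$ be a differential field of characteristic zero, and let $A$ be a (commutative, associative, unital) differential $K$-algebra. Then for all ideals (not necessarily differential) $I_1,\ldots,I_n$ of $A$, $$\left(I_1^{(h_1)}\cdots I_n^{(h_n)}\right)^{\max_{1\leqslant i\leqslant n}(h_i+1)(H-h_i)+1}\subset\left(I_1\cdots I_n\right)^{(h_1+\ldots+h_n)}.$$
   Context: A differential ring is a ring with a derivation; a differential $K$-algebra over a differential field $K$ is a differential ring $A$ that is a $K$-algebra and whose derivation restricts to the derivation of $K$. For an ideal $I$ of a differential ring and $h\in\mathbb{Z}_{\geqslant 0}$, $I^{(h)}$ denotes the ideal generated by all derivatives of order at most $h$ (including order $0$) of elements of $I$. The exponent means $\left(\max_i(h_i+1)(H-h_i)\right)+1$ and denotes an ordinary power of an ideal. *)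

theory Defs
  imports "HOL-Algebra.Algebra"
begin

locale differential_ring = cring R
  for R :: "('a, 'b) ring_scheme" (structure) and d :: "'a \<Rightarrow> 'a" +
  assumes deriv_closed: "x \<in> carrier R \<Longrightarrow> d x \<in> carrier R"
    and deriv_add: "\<lbrakk>x \<in> carrier R; y \<in> carrier R\<rbrakk> \<Longrightarrow> d (x \<oplus> y) = d x \<oplus> d y"
    and deriv_mult: "\<lbrakk>x \<in> carrier R; y \<in> carrier R\<rbrakk> \<Longrightarrow> d (x \<otimes> y) = d x \<otimes> y \<oplus> x \<otimes> d y"

locale differential_field = differential_ring K d + field K
  for K :: "('a, 'b) ring_scheme" (structure) and d :: "'a \<Rightarrow> 'a"

text \<open>The structure map of the algebra sends \<open>c\<close> to \<open>c \<odot> \<one>\<close>, so \<open>deriv_restricts\<close> says that the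
  derivation of \<open>A\<close> restricts to that of \<open>K\<close>. The algebra \<open>A\<close> may be the zero ring.\<close>

locale differential_algebra =
  K: differential_field K dK + algebra K A + A: differential_ring A dA
  for K :: "('k, 'm) ring_scheme" and dK :: "'k \<Rightarrow> 'k"
    and A :: "('k, 'a, 'n) module_scheme" and dA :: "'a \<Rightarrow> 'a" +
  assumes deriv_restricts:
    "c \<in> carrier K \<Longrightarrow> dA (c \<odot>\<^bsub>A\<^esub> \<one>\<^bsub>A\<^esub>) = dK c \<odot>\<^bsub>A\<^esub> \<one>\<^bsub>A\<^esub>"

definition characteristic_zero :: "('a, 'b) ring_scheme \<Rightarrow> bool"
  where "characteristic_zero R \<longleftrightarrow> (\<forall>m::nat. m > 0 \<longrightarrow> [m] \<cdot>\<^bsub>R\<^esub> \<one>\<^bsub>R\<^esub> \<noteq> \<zero>\<^bsub>R\<^esub>)"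

definition deriv_ideal ::
    "('a, 'b) ring_scheme \<Rightarrow> ('a \<Rightarrow> 'a) \<Rightarrow> 'a set \<Rightarrow> nat \<Rightarrow> 'a set"
  where "deriv_ideal R d I h = Idl\<^bsub>R\<^esub> {(d ^^ j) a | j a. j \<le> h \<and> a \<in> I}"

lemma (in differential_ring) deriv_funpow_closed:
  "x \<in> carrier R \<Longrightarrow> (d ^^ j) x \<in> carrier R"
  by (induction j) (auto intro: deriv_closed)

text \<open>In particular \<open>deriv_ideal R d I h\<close> lies in the carrier of the commutative monoid
  \<open>ideals_set R\<close>, as its finite products and powers require.\<close>

lemma (in differential_ring) deriv_ideal_is_ideal:
  assumes "ideal I R"
  shows "ideal (deriv_ideal R d I h) R"
  unfolding deriv_ideal_def
  by (rule genideal_ideal) (auto intro: deriv_funpow_closed ideal.Icarr[OF assms])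

end

theory Submission
  imports Defs
begin

text \<open>Write \<open>a_j = d^j a / j!\<close>, and \<open>a_j = 0\<close> for \<open>j < 0\<close>. The power of the product of ideals is
  generated by the products of \<open>(a_(i,t))_j(i,t)\<close> over \<open>i\<close> and \<open>t < N\<close>, where \<open>a_(i,t) \<in> I i\<close>
  and \<open>j(i,t) \<le> h i\<close>. By the Leibniz rule, for \<open>k \<le> H\<close> and any choice of one label \<open>t\<close> for each
  \<open>i\<close>, the sum of such products over all ways to distribute the total order \<open>k\<close> among the chosen
  labels lies in the target ideal.

  Put \<open>q i = H - h i\<close>, so that the \<open>q i\<close> sum to \<open>(n - 1) H\<close>. A signed combination of the
  Leibniz relations is a product over \<open>i\<close> of determinants of size \<open>q i + 1\<close> with entries
  \<open>(a_(i,t))_(m(t) - e)\<close>, where \<open>0 \<le> e \<le> q i\<close> and \<open>m(t) \<le> H\<close>; no Leibniz relation of higher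
  order is needed. Choosing \<open>q i + 1\<close> labels of order at most \<open>h i\<close> in each group and sorting
  them, a given product is the diagonal term of such a determinant, and all other terms have the
  same total order in each group but a larger sum of squares of orders. So the given product is
  congruent to a combination of more spread out ones, and the process stops. The labels exist as
  long as the total order in group \<open>i\<close> is at most \<open>N h i\<close>: otherwise at least \<open>N - q i\<close> labels
  would have order at least \<open>h i + 1\<close>, hence \<open>(N - q i) (h i + 1) \<le> N h i\<close>, that is,
  \<open>N \<le> (h i + 1) (H - h i)\<close>.\<close>

section \<open>Straightening in the free abelian group on monomials\<close>

lemma ex_monotone_ranking:
  fixes f :: "'a \<Rightarrow> 'b::linorder"
  assumes "finite S"
  shows "\<exists>\<rho>. bij_betw \<rho> S {..<card S} \<and> (\<forall>s\<in>S. \<forall>t\<in>S. \<rho> s \<le> \<rho> t \<longrightarrow> f s \<le> f t)"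
  using assms
proof (induction "card S" arbitrary: S)
  case 0
  then show ?case by (auto simp: bij_betw_def)
next
  case (Suc k)
  then have "S \<noteq> {}" by auto
  then obtain x where x: "x \<in> S" "\<And>s. s \<in> S \<Longrightarrow> f s \<le> f x"
    using Suc.prems Max_in[of "f ` S"] Max_ge[of "f ` S"] by fastforce
  define S' where "S' = S - {x}"
  have S': "S = insert x S'" "x \<notin> S'" "finite S'" "card S' = k"
    using x Suc by (auto simp: S'_def)
  from Suc.hyps(1)[of S'] S' obtain \<rho> where
    \<rho>: "bij_betw \<rho> S' {..<k}" "\<forall>s\<in>S'. \<forall>t\<in>S'. \<rho> s \<le> \<rho> t \<longrightarrow> f s \<le> f t" by auto
  have lt: "\<rho> s < k" if "s \<in> S'" for s
    using \<rho>(1) that by (auto simp: bij_betw_def)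
  define \<rho>' where "\<rho>' = \<rho>(x := k)"
  have "bij_betw \<rho>' S' {..<k}"
    using \<rho>(1) S'(2) by (subst bij_betw_cong[where g = \<rho>]) (auto simp: \<rho>'_def)
  moreover have "bij_betw \<rho>' {x} {k}"
    by (auto simp: \<rho>'_def bij_betw_def)
  ultimately have "bij_betw \<rho>' (S' \<union> {x}) ({..<k} \<union> {k})"
    by (rule bij_betw_combine) auto
  then have "bij_betw \<rho>' S {..<card S}"
    using S' by (simp add: lessThan_Suc)
  moreover have "\<forall>s\<in>S. \<forall>t\<in>S. \<rho>' s \<le> \<rho>' t \<longrightarrow> f s \<le> f t"
  proof (intro ballI impI)
    fix s t assume st: "s \<in> S" "t \<in> S" "\<rho>' s \<le> \<rho>' t"
    show "f s \<le> f t"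
    proof (cases "t = x")
      case False
      then have "\<rho>' t < k" using lt st S' by (auto simp: \<rho>'_def)
      then have "s \<noteq> x" using st by (auto simp: \<rho>'_def)
      then show ?thesis using False st \<rho>(2) S' by (auto simp: \<rho>'_def)
    qed (use x st in auto)
  qed
  ultimately show ?case by blast
qed

text \<open>Abel summation: \<open>g\<close> increases, and the partial sums of
  \<open>int r - int (\<pi> r)\<close> are at most 0 because \<open>k + 1\<close> distinct naturals
  have sum at least \<open>0 + ... + k\<close>.\<close>

lemma sum_mono_mult_displacement_nonneg:
  fixes g :: "nat \<Rightarrow> int"
  assumes \<pi>: "\<pi> permutes {..q}" and mono: "mono_on {..q} g"
  shows "0 \<le> (\<Sum>r\<le>q. g r * (int r - int (\<pi> r)))"
proof -
  have part: "(\<Sum>r\<le>k. int r - int (\<pi> r)) \<le> 0" for k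
  proof -
    have inj: "inj_on \<pi> {..k}"
      using permutes_inj[OF \<pi>] by (rule inj_on_subset) auto
    have "\<Sum> {0..<card (\<pi> ` {..k})} \<le> \<Sum> (\<pi> ` {..k})"
      by (rule card_sum_le_nat_sum)
    then have "(\<Sum>r\<le>k. r) \<le> (\<Sum>r\<le>k. \<pi> r)"
      using inj by (simp add: card_image sum.reindex atLeast0LessThan lessThan_Suc_atMost)
    then have "int (\<Sum>r\<le>k. r) \<le> int (\<Sum>r\<le>k. \<pi> r)" by (rule of_nat_mono)
    then show ?thesis by (simp add: sum_subtractf)
  qed
  \<comment> \<open>The left side is the boundary term; it vanishes at \<open>k = q\<close>, where
    \<open>\<pi>\<close> preserves the sum. Replacing \<open>g k\<close> by \<open>g (Suc k)\<close>
    can only lower it, as the partial sum is not positive.\<close>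
  have abel: "g k * (\<Sum>r\<le>k. int r - int (\<pi> r)) \<le> (\<Sum>r\<le>k. g r * (int r - int (\<pi> r)))" if "k \<le> q" for k
    using that
  proof (induction k)
    case (Suc k)
    have "g k \<le> g (Suc k)" using mono Suc.prems by (auto simp: mono_on_def)
    then have "g (Suc k) * (\<Sum>r\<le>k. int r - int (\<pi> r)) \<le> g k * (\<Sum>r\<le>k. int r - int (\<pi> r))"
      using part[of k] by (rule mult_right_mono_neg)
    then show ?case using Suc by (simp add: distrib_left)
  qed simp
  have "(\<Sum>r\<le>q. int (\<pi> r)) = (\<Sum>r\<le>q. int r)"
    using sum.permute[OF \<pi>, of int] by simp
  then show ?thesis using abel[of q] by (simp add: sum_subtractf)
qed

section \<open>Compositions and shifted Leibniz relations\<close>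

definition compositions :: "'i set \<Rightarrow> nat \<Rightarrow> ('i \<Rightarrow> nat) set"
  where "compositions I k = {b \<in> I \<rightarrow>\<^sub>E {..k}. sum b I = k}"

lemma finite_compositions: "finite I \<Longrightarrow> finite (compositions I k)"
  by (rule finite_subset[of _ "I \<rightarrow>\<^sub>E {..k}"]) (auto simp: compositions_def finite_PiE)

text \<open>A function \<open>j\<close> encodes the product of the \<open>(a_(i,t))_j(i,t)\<close>, and \<open>G\<close> is to be the set of
  integer combinations of such products whose value lies in the target ideal.\<close>

locale arc_relations =
  fixes I :: "'i set" and h :: "'i \<Rightarrow> nat" and H N :: nat
    and G :: "(('i \<times> nat \<Rightarrow> int) \<Rightarrow>\<^sub>0 int) set"
  assumes finite_I: "finite I" and I_nonempty: "I \<noteq> {}"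
    and H_eq: "H = (\<Sum>i\<in>I. h i)"
    and N_gt: "i \<in> I \<Longrightarrow> (h i + 1) * (H - h i) < N"
    and zero_G: "0 \<in> G"
    and add_G: "x \<in> G \<Longrightarrow> y \<in> G \<Longrightarrow> x + y \<in> G"
    and uminus_G: "x \<in> G \<Longrightarrow> - x \<in> G"
    and negative_G: "i \<in> I \<Longrightarrow> t < N \<Longrightarrow> j (i, t) < 0 \<Longrightarrow> frag_of j \<in> G"
    and leibniz_G: "\<tau> \<in> I \<rightarrow> {..<N} \<Longrightarrow> k \<le> H \<Longrightarrow>
      (\<Sum>b\<in>compositions I k.
         frag_of (\<lambda>(i, t). if i \<in> I \<and> t = \<tau> i then int (b i) else j (i, t))) \<in> G"
begin

lemma sum_G: "(\<And>x. x \<in> Y \<Longrightarrow> f x \<in> G) \<Longrightarrow> sum f Y \<in> G"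
  by (induction Y rule: infinite_finite_induct) (auto simp: zero_G add_G)

lemma diff_G: "x \<in> G \<Longrightarrow> y \<in> G \<Longrightarrow> x - y \<in> G"
  using add_G[of x "- y"] uminus_G[of y] by simp

lemma sign_cmul_G: "x \<in> G \<Longrightarrow> frag_cmul (\<Prod>i\<in>Y. sign (\<pi> i)) x \<in> G"
proof -
  assume x: "x \<in> G"
  have "(\<Prod>i\<in>Y. sign (\<pi> i)) = 1 \<or> (\<Prod>i\<in>Y. sign (\<pi> i)) = - 1"
    by (induction Y rule: infinite_finite_induct) (auto simp: sign_def)
  then show ?thesis using x by (auto simp: uminus_G)
qed

lemma h_le_H: "i \<in> I \<Longrightarrow> h i \<le> H"
  unfolding H_eq using finite_I by (meson member_le_sum zero_le)

definition q :: "'i \<Rightarrow> nat" where "q i = H - h i"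

text \<open>\<open>a i\<close> will be the number of the column put in place of the last one in the
  \<open>i\<close>-th determinant. The prescribed total is that of \<open>q\<close>, by
  \<open>sum_q\<close>.\<close>

definition tuples :: "('i \<Rightarrow> nat) set"
  where "tuples = {a \<in> I \<rightarrow>\<^sub>E {..H}. sum a I = (card I - 1) * H}"

lemma finite_tuples: "finite tuples"
  by (rule finite_subset[of _ "I \<rightarrow>\<^sub>E {..H}"]) (auto simp: tuples_def finite_PiE finite_I)

lemma int_card_I: "int ((card I - 1) * H) = int (card I) * int H - int H"
proof -
  have "card I \<ge> 1" using finite_I I_nonempty by (simp add: Suc_leI card_gt_0_iff)
  then show ?thesis by (simp add: of_nat_diff algebra_simps)
qed

lemma sum_q: "sum q I = (card I - 1) * H"
proof -
  have "int (sum q I) = (\<Sum>i\<in>I. int H - int (h i))"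
    unfolding q_def of_nat_sum by (intro sum.cong) (auto simp: h_le_H of_nat_diff)
  also have "\<dots> = int (card I) * int H - int H"
    by (simp add: sum_subtractf H_eq)
  finally show ?thesis using int_card_I by linarith
qed

text \<open>Substituting \<open>b i = M i - a i\<close> turns the tuples without negative orders
  into the compositions of the common total order \<open>K\<close>. As \<open>M i \<le> H\<close>
  and the \<open>a i\<close> add up to \<open>(card I - 1) * H\<close>, this total is at most
  \<open>H\<close>, where Leibniz relations are available. The other tuples give elements of
  \<open>G\<close> by \<open>negative_G\<close>.\<close>

lemma shifted_leibniz_G:
  assumes \<tau>: "\<tau> \<in> I \<rightarrow> {..<N}" and M: "\<And>i. i \<in> I \<Longrightarrow> M i \<le> int H"
  shows "(\<Sum>a\<in>tuples. frag_of (\<lambda>(i, t). if i \<in> I \<and> t = \<tau> i then M i - int (a i) else j (i, t))) \<in> G"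
    (is "(\<Sum>a\<in>tuples. frag_of (?F a)) \<in> G")
proof -
  define good where "good = {a \<in> tuples. \<forall>i\<in>I. int (a i) \<le> M i}"
  define K where "K = sum M I - int ((card I - 1) * H)"
  have "sum M I \<le> int (card I) * int H"
    using sum_bounded_above[of I M "int H"] M by simp
  then have K_le: "K \<le> int H" unfolding K_def int_card_I by simp
  have bad: "frag_of (?F a) \<in> G" if a: "a \<in> tuples - good" for a
  proof -
    obtain i where i: "i \<in> I" "M i < int (a i)"
      using a by (auto simp: good_def not_le)
    show ?thesis
      by (rule negative_G[of i "\<tau> i"]) (use i \<tau> in auto)
  qed
  have sum_a: "(\<Sum>i\<in>I. M i - int (a i)) = K" if "a \<in> tuples" for a
    using that by (auto simp: tuples_def K_def sum_subtractf simp flip: of_nat_sum)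
  have "(\<Sum>a\<in>good. frag_of (?F a)) \<in> G"
  proof (cases "K < 0")
    case True
    have "good = {}"
    proof (rule ccontr)
      assume "good \<noteq> {}"
      then obtain a where a: "a \<in> tuples" "\<And>i. i \<in> I \<Longrightarrow> int (a i) \<le> M i"
        by (auto simp: good_def)
      have "0 \<le> (\<Sum>i\<in>I. M i - int (a i))" using a(2) by (intro sum_nonneg) simp
      then show False using sum_a[OF a(1)] True by simp
    qed
    then show ?thesis using zero_G by simp
  next
    case False
    define k where "k = nat K"
    have k: "int k = K" "k \<le> H" using False K_le by (auto simp: k_def)
    \<comment> \<open>Complementation in \<open>M\<close> is its own inverse, so it serves in both
      directions of the bijection.\<close>
    define \<phi> where "\<phi> a = (\<lambda>i\<in>I. nat (M i - int (a i)))" for a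
    have "(\<Sum>a\<in>good. frag_of (?F a)) =
      (\<Sum>b\<in>compositions I k. frag_of (\<lambda>(i, t). if i \<in> I \<and> t = \<tau> i then int (b i) else j (i, t)))"
    proof (rule sum.reindex_bij_witness[where i = \<phi> and j = \<phi>])
      fix a assume a: "a \<in> good"
      then have a': "a \<in> tuples" "\<And>i. i \<in> I \<Longrightarrow> int (a i) \<le> M i"
        by (auto simp: good_def)
      show "\<phi> (\<phi> a) = a"
        using a' by (auto simp: \<phi>_def tuples_def fun_eq_iff PiE_def extensional_def)
      have int_\<phi>: "int (\<phi> a i) = M i - int (a i)" if "i \<in> I" for i
        using a'(2)[OF that] that by (simp add: \<phi>_def)
      have "int (sum (\<phi> a) I) = K"
        using sum_a[OF a'(1)] int_\<phi> by simp
      then have s: "sum (\<phi> a) I = k" using k(1) by (metis of_nat_eq_iff)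
      then have "\<phi> a i \<le> k" if "i \<in> I" for i
        using member_le_sum[of i I "\<phi> a"] that finite_I by simp
      then show "\<phi> a \<in> compositions I k"
        using s by (auto simp: compositions_def \<phi>_def)
      show "frag_of (\<lambda>(i, t). if i \<in> I \<and> t = \<tau> i then int (\<phi> a i) else j (i, t)) = frag_of (?F a)"
        using int_\<phi> by (intro arg_cong[where f = frag_of]) (auto simp: fun_eq_iff)
    next
      fix b assume b: "b \<in> compositions I k"
      \<comment> \<open>Every composition must come from a tuple: the other \<open>M l\<close> add
        up to at most \<open>(card I - 1) * H\<close>, so \<open>M i\<close> is at least
        \<open>K\<close>, hence at least \<open>b i\<close>.\<close>
      have b_le: "int (b i) \<le> M i" if i: "i \<in> I" for i
      proof -
        have "sum b (I - {i}) = k - b i"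
          using b i finite_I by (simp add: compositions_def sum_diff1_nat)
        moreover have "b i \<le> k" using b i by (auto simp: compositions_def)
        ultimately have "int (b i) = K - (\<Sum>l\<in>I - {i}. int (b l))"
          using k by (simp flip: of_nat_sum)
        also have "\<dots> \<le> K" by (simp add: sum_nonneg)
        also have "K = M i + (sum M (I - {i}) - int ((card I - 1) * H))"
          using i finite_I by (simp add: K_def sum.remove)
        also have "sum M (I - {i}) \<le> int ((card I - 1) * H)"
          using sum_bounded_above[of "I - {i}" M "int H"] M i finite_I by simp
        finally show ?thesis by simp
      qed
      show "\<phi> (\<phi> b) = b"
        using b b_le by (auto simp: \<phi>_def compositions_def fun_eq_iff PiE_def extensional_def)
      have int_\<phi>: "int (\<phi> b i) = M i - int (b i)" if "i \<in> I" for i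
        using b_le[OF that] that by (simp add: \<phi>_def)
      have "\<phi> b i \<le> H" if "i \<in> I" for i
        using int_\<phi>[OF that] M[OF that] by linarith
      moreover have "int (sum (\<phi> b) I) = sum M I - K"
        using b k int_\<phi> by (simp add: sum_subtractf compositions_def) (simp flip: of_nat_sum)
      then have "sum (\<phi> b) I = (card I - 1) * H"
        unfolding K_def by linarith
      ultimately show "\<phi> b \<in> good"
        using int_\<phi> by (auto simp: good_def tuples_def \<phi>_def)
    qed
    then show ?thesis using leibniz_G[OF \<tau> k(2)] by simp
  qed
  moreover have "(\<Sum>a\<in>tuples - good. frag_of (?F a)) \<in> G"
    by (rule sum_G) (rule bad)
  moreover have "(\<Sum>a\<in>tuples. frag_of (?F a)) =
      (\<Sum>a\<in>tuples - good. frag_of (?F a)) + (\<Sum>a\<in>good. frag_of (?F a))"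
    by (rule sum.subset_diff) (auto simp: good_def finite_tuples)
  ultimately show ?thesis using add_G by simp
qed


section \<open>Products of determinants\<close>

definition perms :: "('i \<Rightarrow> nat \<Rightarrow> nat) set"
  where "perms = (\<Pi>\<^sub>E i\<in>I. {\<pi>. \<pi> permutes {..q i}})"

text \<open>Adding the rank \<open>\<rho>\<close> compensates the column number on the diagonal, so
  that identity permutations with \<open>a = q\<close> give back \<open>j\<close>. Column
  \<open>q i\<close> is exchanged for column \<open>a i\<close>; the other columns are kept.\<close>

definition shift :: "('i \<Rightarrow> nat set) \<Rightarrow> ('i \<times> nat \<Rightarrow> nat) \<Rightarrow> ('i \<times> nat \<Rightarrow> int) \<Rightarrow>
    ('i \<Rightarrow> nat \<Rightarrow> nat) \<Rightarrow> ('i \<Rightarrow> nat) \<Rightarrow> 'i \<times> nat \<Rightarrow> int"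
  where "shift S \<rho> j \<pi> a = (\<lambda>(i, t). if i \<in> I \<and> t \<in> S i
    then j (i, t) + int (\<rho> (i, t)) - int (if \<pi> i (\<rho> (i, t)) = q i then a i else \<pi> i (\<rho> (i, t)))
    else j (i, t))"

definition sgn_perms :: "('i \<Rightarrow> nat \<Rightarrow> nat) \<Rightarrow> int"
  where "sgn_perms \<pi> = (\<Prod>i\<in>I. sign (\<pi> i))"

lemma finite_perms: "finite perms"
  by (auto simp: perms_def finite_I intro!: finite_PiE finite_permutations)

lemma permsD: "\<pi> \<in> perms \<Longrightarrow> i \<in> I \<Longrightarrow> \<pi> i permutes {..q i}"
  by (auto simp: perms_def)

context
  fixes S :: "'i \<Rightarrow> nat set" and \<rho> :: "'i \<times> nat \<Rightarrow> nat" and j :: "'i \<times> nat \<Rightarrow> int"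
  assumes S: "\<And>i. i \<in> I \<Longrightarrow> S i \<subseteq> {..<N}"
    and \<rho>: "\<And>i. i \<in> I \<Longrightarrow> bij_betw (\<lambda>t. \<rho> (i, t)) (S i) {..q i}"
    and j\<rho>: "\<And>i t. i \<in> I \<Longrightarrow> t \<in> S i \<Longrightarrow> j (i, t) + int (\<rho> (i, t)) \<le> int H"
begin

text \<open>For fixed \<open>\<pi>\<close>, exactly one row of each group takes the last column, and
  only its order depends on \<open>a\<close>. So the sum over \<open>a\<close> is a shifted Leibniz
  relation for these rows.\<close>

lemma sum_tuples_shift_G:
  assumes \<pi>: "\<pi> \<in> perms"
  shows "(\<Sum>a\<in>tuples. frag_of (shift S \<rho> j \<pi> a)) \<in> G"
proof -
  have "\<exists>t\<in>S i. \<pi> i (\<rho> (i, t)) = q i" if i: "i \<in> I" for i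
  proof -
    have "q i \<in> \<pi> i ` {..q i}"
      using permutes_image[OF permsD[OF \<pi> i]] by simp
    then show ?thesis using bij_betw_imp_surj_on[OF \<rho>[OF i]] by force
  qed
  then obtain \<tau> where \<tau>: "\<And>i. i \<in> I \<Longrightarrow> \<tau> i \<in> S i" "\<And>i. i \<in> I \<Longrightarrow> \<pi> i (\<rho> (i, \<tau> i)) = q i"
    by metis
  have \<tau>_unique: "t = \<tau> i" if "i \<in> I" "t \<in> S i" "\<pi> i (\<rho> (i, t)) = q i" for i t
  proof -
    have "\<rho> (i, t) = \<rho> (i, \<tau> i)"
      using permutes_inj[OF permsD[OF \<pi> that(1)]] that \<tau> by (metis injD)
    then show ?thesis
      using \<rho>[OF that(1)] that \<tau> by (auto simp: bij_betw_def dest!: inj_onD)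
  qed
  \<comment> \<open>\<open>\<lambda>_. 0\<close> is an arbitrary filler: away from the labels
    \<open>\<tau> i\<close> the shifted order does not depend on \<open>a\<close>.\<close>
  have "shift S \<rho> j \<pi> a = (\<lambda>(i, t). if i \<in> I \<and> t = \<tau> i
      then (j (i, \<tau> i) + int (\<rho> (i, \<tau> i))) - int (a i) else shift S \<rho> j \<pi> (\<lambda>_. 0) (i, t))" for a
    using \<tau> \<tau>_unique by (auto simp: shift_def fun_eq_iff)
  moreover have "(\<Sum>a\<in>tuples. frag_of (\<lambda>(i, t). if i \<in> I \<and> t = \<tau> i
      then (j (i, \<tau> i) + int (\<rho> (i, \<tau> i))) - int (a i) else shift S \<rho> j \<pi> (\<lambda>_. 0) (i, t))) \<in> G"
    by (rule shifted_leibniz_G) (use \<tau> S j\<rho> in auto)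
  ultimately show ?thesis by simp
qed

text \<open>A determinant with two equal columns vanishes: column \<open>a i0\<close> stands both in
  its own place and in the last one. Composing with the transposition of these places reverses the
  sign and keeps the monomial.\<close>

lemma sum_perms_shift_eq_0:
  assumes i0: "i0 \<in> I" "a i0 < q i0"
  shows "(\<Sum>\<pi>\<in>perms. frag_cmul (sgn_perms \<pi>) (frag_of (shift S \<rho> j \<pi> a))) = 0" (is "?s = 0")
proof -
  define sw where "sw = transpose (a i0) (q i0)"
  define \<psi> where "\<psi> \<pi> = \<pi>(i0 := sw \<circ> \<pi> i0)" for \<pi> :: "'i \<Rightarrow> nat \<Rightarrow> nat"
  have sw: "sw permutes {..q i0}" unfolding sw_def
    by (rule permutes_swap_id) (use i0 in auto)
  have sw_sw: "sw \<circ> (sw \<circ> f) = f" for f :: "nat \<Rightarrow> nat"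
    by (simp add: sw_def flip: comp_assoc)
  have \<psi>_perms: "\<psi> \<pi> \<in> perms" if "\<pi> \<in> perms" for \<pi>
    using that i0 permutes_compose[OF permsD[OF that i0(1)] sw]
    by (auto simp: perms_def \<psi>_def PiE_def extensional_def)
  have \<psi>\<psi>: "\<psi> (\<psi> \<pi>) = \<pi>" for \<pi>
    by (simp add: \<psi>_def sw_sw)
  have sgn: "sgn_perms (\<psi> \<pi>) = - sgn_perms \<pi>" if "\<pi> \<in> perms" for \<pi>
  proof -
    have "permutation (\<pi> i0)" "permutation sw"
      using permsD[OF that i0(1)] sw by (auto intro: permutation_permutes[THEN iffD2])
    then have "sign (sw \<circ> \<pi> i0) = - sign (\<pi> i0)"
      using i0 by (simp add: sign_compose sw_def sign_swap_id)
    then show ?thesis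
      using i0 finite_I by (simp add: sgn_perms_def prod.remove[of I i0] \<psi>_def)
  qed
  have shift: "shift S \<rho> j (\<psi> \<pi>) a = shift S \<rho> j \<pi> a" for \<pi>
    using i0 by (auto simp: shift_def \<psi>_def sw_def transpose_def fun_eq_iff)
  have "?s = (\<Sum>\<pi>\<in>perms. frag_cmul (sgn_perms (\<psi> \<pi>)) (frag_of (shift S \<rho> j (\<psi> \<pi>) a)))"
    by (rule sum.reindex_bij_witness[where i = \<psi> and j = \<psi>]) (auto simp: \<psi>\<psi> \<psi>_perms)
  also have "\<dots> = - ?s"
    by (simp add: sgn shift sum_negf flip: minus_frag_cmul)
  finally have eq: "?s = - ?s" .
  \<comment> \<open>The coefficients are integers, so \<open>?s = - ?s\<close> forces
    \<open>?s = 0\<close>.\<close>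
  show ?thesis
  proof (rule poly_mapping_eqI)
    fix x
    have "Poly_Mapping.lookup ?s x = - Poly_Mapping.lookup ?s x"
      by (subst eq) (rule lookup_uminus)
    then show "Poly_Mapping.lookup ?s x = Poly_Mapping.lookup 0 x" by simp
  qed
qed

text \<open>An expansion of a product of determinants, one for each \<open>i \<in> I\<close>, in which
  \<open>j (i, t) + \<rho> (i, t) - e\<close> is the index of the entry in row \<open>t\<close> and column \<open>e \<le> q i\<close>.
  Replacing the last column by column \<open>a i\<close> gives \<open>0\<close> if \<open>a i < q i\<close>; hence summing
  over all \<open>a\<close> with fixed sum leaves only \<open>a = q\<close>.\<close>

lemma sum_perms_G:
  "(\<Sum>\<pi>\<in>perms. frag_cmul (sgn_perms \<pi>) (frag_of (shift S \<rho> j \<pi> q))) \<in> G"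
proof -
  define q' where "q' = restrict q I"
  have q': "q' \<in> tuples"
    using sum_q by (auto simp: tuples_def q'_def q_def)
  have "(\<Sum>\<pi>\<in>perms. frag_cmul (sgn_perms \<pi>) (frag_of (shift S \<rho> j \<pi> a))) = 0"
    if a: "a \<in> tuples - {q'}" for a
  proof -
    \<comment> \<open>\<open>a\<close> and \<open>q\<close> have the same sum over \<open>I\<close>,
      so \<open>a\<close> cannot dominate \<open>q\<close> without agreeing with it there.\<close>
    have "\<exists>i\<in>I. a i < q i"
    proof (rule ccontr)
      assume "\<not> (\<exists>i\<in>I. a i < q i)"
      then have le: "\<And>i. i \<in> I \<Longrightarrow> q i \<le> a i" by (auto simp: not_less)
      have "a i = q i" if "i \<in> I" for i
        using sum_mono_inv[of q I a i] le that finite_I sum_q a by (auto simp: tuples_def)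
      then have "a = q'" using a by (auto simp: tuples_def q'_def fun_eq_iff PiE_def extensional_def)
      then show False using a by simp
    qed
    then show ?thesis using sum_perms_shift_eq_0 by blast
  qed
  then have "(\<Sum>a\<in>tuples. \<Sum>\<pi>\<in>perms. frag_cmul (sgn_perms \<pi>) (frag_of (shift S \<rho> j \<pi> a)))
    = (\<Sum>\<pi>\<in>perms. frag_cmul (sgn_perms \<pi>) (frag_of (shift S \<rho> j \<pi> q')))"
    using q' by (simp add: sum.remove[OF finite_tuples])
  moreover have "shift S \<rho> j \<pi> q' = shift S \<rho> j \<pi> q" for \<pi>
    by (auto simp: shift_def q'_def fun_eq_iff)
  moreover have "(\<Sum>a\<in>tuples. \<Sum>\<pi>\<in>perms. frag_cmul (sgn_perms \<pi>) (frag_of (shift S \<rho> j \<pi> a)))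
    = (\<Sum>\<pi>\<in>perms. frag_cmul (sgn_perms \<pi>) (\<Sum>a\<in>tuples. frag_of (shift S \<rho> j \<pi> a)))"
    by (subst sum.swap) (simp add: frag_cmul_sum)
  moreover have "\<dots> \<in> G"
    unfolding sgn_perms_def by (intro sum_G sign_cmul_G sum_tuples_shift_G)
  ultimately show ?thesis by simp
qed

end


section \<open>Labels of low order and termination\<close>

lemma low_labels:
  assumes "i \<in> I" and nonneg: "\<And>t. t < N \<Longrightarrow> 0 \<le> j (i, t)"
    and weight: "(\<Sum>t<N. j (i, t)) \<le> int (N * h i)"
  shows "q i < card {t \<in> {..<N}. j (i, t) \<le> int (h i)}" (is "_ < card ?T")
proof (rule ccontr)
  assume "\<not> q i < card ?T"
  then have T: "card ?T \<le> q i" by simp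
  have T_N: "card ?T \<le> N" using card_mono[of "{..<N}" ?T] by auto
  \<comment> \<open>Labels outside \<open>?T\<close> have order at least \<open>h i + 1\<close>. If
    \<open>?T\<close> had at most \<open>q i\<close> elements, the weight bound would force
    \<open>N \<le> (h i + 1) * (H - h i)\<close>.\<close>
  have "int (N - card ?T) * (int (h i) + 1) = (\<Sum>t\<in>{..<N} - ?T. int (h i) + 1)"
    by (subst sum_constant, subst card_Diff_subset) auto
  also have "\<dots> \<le> (\<Sum>t\<in>{..<N} - ?T. j (i, t))"
    by (rule sum_mono) auto
  also have "\<dots> \<le> (\<Sum>t<N. j (i, t))"
    using nonneg by (intro sum_mono2) auto
  finally have "(int N - int (card ?T)) * (int (h i) + 1) \<le> int N * int (h i)"
    using weight T_N by (simp add: of_nat_diff)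
  then have "int N \<le> int (card ?T) * (int (h i) + 1)"
    by (simp add: algebra_simps)
  moreover have "int (card ?T) * (int (h i) + 1) \<le> int (q i) * (int (h i) + 1)"
    using T by (intro mult_right_mono) auto
  moreover have "int (q i) * (int (h i) + 1) = int ((h i + 1) * (H - h i))"
    unfolding q_def of_nat_mult by (simp add: mult.commute)
  ultimately show False using N_gt[OF assms(1)] by linarith
qed

lemma ex_sorted_low_labels:
  assumes "i \<in> I" "\<And>t. t < N \<Longrightarrow> 0 \<le> j (i, t)" "(\<Sum>t<N. j (i, t)) \<le> int (N * h i)"
  shows "\<exists>S \<rho>. S \<subseteq> {..<N} \<and> bij_betw \<rho> S {..q i} \<and> (\<forall>t\<in>S. j (i, t) \<le> int (h i)) \<and>
    (\<forall>s\<in>S. \<forall>t\<in>S. \<rho> s \<le> \<rho> t \<longrightarrow> j (i, s) \<le> j (i, t))"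
proof -
  have "Suc (q i) \<le> card {t \<in> {..<N}. j (i, t) \<le> int (h i)}"
    using low_labels[OF assms] by simp
  then obtain S where S: "S \<subseteq> {t \<in> {..<N}. j (i, t) \<le> int (h i)}" "card S = Suc (q i)" "finite S"
    by (rule obtain_subset_with_card_n)
  obtain \<rho> where "bij_betw \<rho> S {..<card S}" "\<forall>s\<in>S. \<forall>t\<in>S. \<rho> s \<le> \<rho> t \<longrightarrow> j (i, s) \<le> j (i, t)"
    using ex_monotone_ranking[OF S(3), of "\<lambda>t. j (i, t)"] by blast
  then show ?thesis
    using S(1,2) by (intro exI[of _ S] exI[of _ \<rho>]) (auto simp: lessThan_Suc_atMost)
qed

text \<open>After expanding the squares, the cross term is nonnegative by the rearrangement
  inequality, since \<open>f\<close> does not decrease with the rank. Hence every nontrivial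
  permutation strictly spreads the orders.\<close>

lemma sum_square_displacement:
  fixes f :: "nat \<Rightarrow> int" and \<rho> :: "nat \<Rightarrow> nat"
  assumes \<pi>: "\<pi> permutes {..n}" and \<rho>: "bij_betw \<rho> S {..n}"
    and mono: "\<And>s t. s \<in> S \<Longrightarrow> t \<in> S \<Longrightarrow> \<rho> s \<le> \<rho> t \<Longrightarrow> f s \<le> f t"
  shows "(\<Sum>t\<in>S. (f t)\<^sup>2) + (\<Sum>r\<le>n. (int r - int (\<pi> r))\<^sup>2)
      \<le> (\<Sum>t\<in>S. (f t + int (\<rho> t) - int (\<pi> (\<rho> t)))\<^sup>2)"
proof -
  define g where "g r = f (inv_into S \<rho> r)" for r
  have g: "g (\<rho> t) = f t" if "t \<in> S" for t
    using bij_betw_inv_into_left[OF \<rho> that] by (simp add: g_def)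
  have reindex: "(\<Sum>t\<in>S. F (\<rho> t)) = (\<Sum>r\<le>n. F r)" for F :: "nat \<Rightarrow> int"
    by (rule sum.reindex_bij_betw[OF \<rho>])
  have "mono_on {..n} g"
  proof (rule mono_onI)
    fix r s assume "r \<in> {..n}" "s \<in> {..n}" "r \<le> s"
    moreover have "{..n} = \<rho> ` S" using \<rho> by (simp add: bij_betw_def)
    ultimately show "g r \<le> g s" using mono by (auto simp: g)
  qed
  then have "0 \<le> (\<Sum>r\<le>n. g r * (int r - int (\<pi> r)))"
    by (rule sum_mono_mult_displacement_nonneg[OF \<pi>])
  also have "\<dots> = (\<Sum>t\<in>S. f t * (int (\<rho> t) - int (\<pi> (\<rho> t))))"
    by (simp add: g flip: reindex)
  finally have "0 \<le> \<dots>" .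
  moreover have "(\<Sum>t\<in>S. (f t + int (\<rho> t) - int (\<pi> (\<rho> t)))\<^sup>2) =
     (\<Sum>t\<in>S. (f t)\<^sup>2) + 2 * (\<Sum>t\<in>S. f t * (int (\<rho> t) - int (\<pi> (\<rho> t))))
      + (\<Sum>t\<in>S. (int (\<rho> t) - int (\<pi> (\<rho> t)))\<^sup>2)"
    unfolding sum_distrib_left sum.distrib[symmetric]
    by (rule sum.cong) (auto simp: power2_eq_square algebra_simps)
  ultimately show ?thesis
    using reindex[of "\<lambda>r. (int r - int (\<pi> r))\<^sup>2"] by linarith
qed

text \<open>Induction on the gap between the sum of squares \<open>Q j\<close> and the bound
  \<open>C\<close>. A monomial with a negative order may exceed \<open>C\<close>, but it lies in
  \<open>G\<close> at once; the bound is used for nonnegative orders only.\<close>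

theorem frag_of_G:
  assumes "\<And>i. i \<in> I \<Longrightarrow> (\<Sum>t<N. j (i, t)) \<le> int (N * h i)"
  shows "frag_of j \<in> G"
proof -
  define Q where "Q j = (\<Sum>i\<in>I. \<Sum>t<N. (j (i, t))\<^sup>2)" for j :: "'i \<times> nat \<Rightarrow> int"
  define C where "C = (\<Sum>i\<in>I. (int (N * h i))\<^sup>2)"
  show ?thesis using assms
  proof (induction "nat (C + 1 - Q j)" arbitrary: j rule: less_induct)
    case less
    note weight = less.prems
    show ?case
    proof (cases "\<exists>i\<in>I. \<exists>t<N. j (i, t) < 0")
      case True
      then show ?thesis using negative_G by blast
    next
      case False
      then have nonneg: "\<And>i t. i \<in> I \<Longrightarrow> t < N \<Longrightarrow> 0 \<le> j (i, t)" by (meson linorder_not_less)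
      have "\<forall>i\<in>I. \<exists>S \<rho>. S \<subseteq> {..<N} \<and> bij_betw \<rho> S {..q i} \<and> (\<forall>t\<in>S. j (i, t) \<le> int (h i)) \<and>
          (\<forall>s\<in>S. \<forall>t\<in>S. \<rho> s \<le> \<rho> t \<longrightarrow> j (i, s) \<le> j (i, t))"
        using ex_sorted_low_labels nonneg weight by blast
      then obtain S \<rho>' where
        S: "\<And>i. i \<in> I \<Longrightarrow> S i \<subseteq> {..<N}" and
        \<rho>': "\<And>i. i \<in> I \<Longrightarrow> bij_betw (\<rho>' i) (S i) {..q i}" and
        low: "\<And>i t. i \<in> I \<Longrightarrow> t \<in> S i \<Longrightarrow> j (i, t) \<le> int (h i)" and
        sorted: "\<And>i s t. i \<in> I \<Longrightarrow> s \<in> S i \<Longrightarrow> t \<in> S i \<Longrightarrow> \<rho>' i s \<le> \<rho>' i t \<Longrightarrow> j (i, s) \<le> j (i, t)"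
        by metis
      define \<rho> where "\<rho> = (\<lambda>(i, t). \<rho>' i t)"
      have \<rho>: "bij_betw (\<lambda>t. \<rho> (i, t)) (S i) {..q i}" if "i \<in> I" for i
        using \<rho>'[OF that] by (simp add: \<rho>_def)
      \<comment> \<open>This is what the low labels are for: an order at most \<open>h i\<close>
        plus a rank at most \<open>H - h i\<close> does not exceed \<open>H\<close>.\<close>
      have j\<rho>: "j (i, t) + int (\<rho> (i, t)) \<le> int H" if "i \<in> I" "t \<in> S i" for i t
      proof -
        have "\<rho> (i, t) \<le> q i" using \<rho>[OF that(1)] that(2) by (auto simp: bij_betw_def)
        then show ?thesis using low[OF that] h_le_H[OF that(1)] by (simp add: q_def)
      qed
      note sum_G' = sum_perms_G[of S \<rho> j, OF S \<rho> j\<rho>]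
      define shf where "shf \<pi> = shift S \<rho> j \<pi> q" for \<pi>
      have shf: "shf \<pi> (i, t) = (if t \<in> S i then j (i, t) + int (\<rho> (i, t)) - int (\<pi> i (\<rho> (i, t))) else j (i, t))"
        if "i \<in> I" for \<pi> i t
        using that by (simp add: shf_def shift_def)
      have split: "(\<Sum>t<N. f t) = (\<Sum>t\<in>{..<N} - S i. f t) + (\<Sum>t\<in>S i. f t)"
        if "i \<in> I" for i and f :: "nat \<Rightarrow> int"
        using S[OF that] by (rule sum.subset_diff) simp
      define e where "e = (\<lambda>i\<in>I. id :: nat \<Rightarrow> nat)"
      have e: "e \<in> perms" by (auto simp: e_def perms_def permutes_id)
      have shf_e: "shf e = j"
        by (auto simp: shf_def shift_def e_def fun_eq_iff)
      have shf_G: "frag_of (shf \<pi>) \<in> G" if \<pi>: "\<pi> \<in> perms - {e}" for \<pi>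
      proof (rule less.hyps)
        have perm: "\<pi> i permutes {..q i}" if "i \<in> I" for i
          using \<pi> that permsD by blast
        show "(\<Sum>t<N. shf \<pi> (i, t)) \<le> int (N * h i)" if i: "i \<in> I" for i
        proof -
          \<comment> \<open>\<open>\<pi> i\<close> only permutes the ranks, so each group keeps its
            total order.\<close>
          have "(\<Sum>t\<in>S i. int (\<pi> i (\<rho> (i, t)))) = (\<Sum>t\<in>S i. int (\<rho> (i, t)))"
            using sum.reindex_bij_betw[OF \<rho>[OF i], of "\<lambda>r. int (\<pi> i r)"]
              sum.reindex_bij_betw[OF \<rho>[OF i], of int] sum.permute[OF perm[OF i], of int]
            by simp
          then have "(\<Sum>t<N. shf \<pi> (i, t)) = (\<Sum>t<N. j (i, t))"
            using i by (simp add: split shf sum.distrib sum_subtractf)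
          then show ?thesis using weight[OF i] by simp
        qed
        have ge: "(\<Sum>t<N. (j (i, t))\<^sup>2) + (\<Sum>r\<le>q i. (int r - int (\<pi> i r))\<^sup>2) \<le> (\<Sum>t<N. (shf \<pi> (i, t))\<^sup>2)"
          if i: "i \<in> I" for i
        proof -
          have "(\<Sum>t\<in>S i. (j (i, t))\<^sup>2) + (\<Sum>r\<le>q i. (int r - int (\<pi> i r))\<^sup>2)
            \<le> (\<Sum>t\<in>S i. (j (i, t) + int (\<rho> (i, t)) - int (\<pi> i (\<rho> (i, t))))\<^sup>2)"
            by (rule sum_square_displacement[OF perm[OF i] \<rho>[OF i]])
              (use sorted i in \<open>auto simp: \<rho>_def\<close>)
          then show ?thesis using i by (simp add: split shf)
        qed
        obtain i0 where i0: "i0 \<in> I" "\<pi> i0 \<noteq> id"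
        proof -
          have "\<pi> = e" if "\<forall>i\<in>I. \<pi> i = id"
            using that \<pi> by (auto simp: e_def perms_def fun_eq_iff PiE_def extensional_def)
          then show thesis using that \<pi> by blast
        qed
        then obtain r where r: "\<pi> i0 r \<noteq> r" by (auto simp: fun_eq_iff)
        then have "r \<in> {..q i0}" using perm[OF i0(1)] permutes_not_in by metis
        then have "0 < (\<Sum>r\<le>q i0. (int r - int (\<pi> i0 r))\<^sup>2)"
          using r by (intro sum_pos2[of _ r]) auto
        then have "(\<Sum>t<N. (j (i0, t))\<^sup>2) < (\<Sum>t<N. (shf \<pi> (i0, t))\<^sup>2)"
          using ge[OF i0(1)] by linarith
        moreover have "(\<Sum>t<N. (j (i, t))\<^sup>2) \<le> (\<Sum>t<N. (shf \<pi> (i, t))\<^sup>2)" if "i \<in> I" for i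
        proof -
          have "0 \<le> (\<Sum>r\<le>q i. (int r - int (\<pi> i r))\<^sup>2)" by (rule sum_nonneg) simp
          then show ?thesis using ge[OF that] by linarith
        qed
        ultimately have "Q j < Q (shf \<pi>)"
          unfolding Q_def using i0(1) finite_I by (intro sum_strict_mono_ex1) auto
        moreover have "Q j \<le> C"
          unfolding Q_def C_def
        proof (rule sum_mono)
          fix i assume i: "i \<in> I"
          have "(\<Sum>t<N. (j (i, t))\<^sup>2) \<le> (\<Sum>t<N. j (i, t) * (\<Sum>t<N. j (i, t)))"
            unfolding power2_eq_square
            by (intro sum_mono mult_left_mono member_le_sum) (use nonneg i in auto)
          also have "\<dots> = (\<Sum>t<N. j (i, t))\<^sup>2"
            by (simp add: power2_eq_square sum_distrib_right)
          also have "\<dots> \<le> (int (N * h i))\<^sup>2"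
            using weight[OF i] nonneg i by (intro power_mono sum_nonneg) auto
          finally show "(\<Sum>t<N. (j (i, t))\<^sup>2) \<le> (int (N * h i))\<^sup>2" by simp
        qed
        ultimately show "nat (C + 1 - Q (shf \<pi>)) < nat (C + 1 - Q j)" by linarith
      qed
      have "(\<Sum>\<pi>\<in>perms. frag_cmul (sgn_perms \<pi>) (frag_of (shf \<pi>))) \<in> G"
        using sum_G' by (simp add: shf_def)
      moreover have "(\<Sum>\<pi>\<in>perms - {e}. frag_cmul (sgn_perms \<pi>) (frag_of (shf \<pi>))) \<in> G"
        unfolding sgn_perms_def by (intro sum_G sign_cmul_G shf_G)
      moreover have "sgn_perms e = 1"
        by (simp add: sgn_perms_def e_def)
      then have "(\<Sum>\<pi>\<in>perms. frag_cmul (sgn_perms \<pi>) (frag_of (shf \<pi>))) =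
          frag_of j + (\<Sum>\<pi>\<in>perms - {e}. frag_cmul (sgn_perms \<pi>) (frag_of (shf \<pi>)))"
        by (simp add: sum.remove[OF finite_perms e] shf_e)
      ultimately show ?thesis
        using diff_G by fastforce
    qed
  qed
qed

end

section \<open>Divided powers of the derivation\<close>

context differential_ring
begin

lemma deriv_zero: "d \<zero> = \<zero>"
proof -
  have "d \<zero> \<oplus> d \<zero> = d \<zero> \<oplus> \<zero>" using deriv_add[of \<zero> \<zero>] deriv_closed[of \<zero>] by simp
  then show ?thesis using deriv_closed by (metis add.l_cancel zero_closed)
qed

lemma deriv_one: "d \<one> = \<zero>"
proof -
  have "d \<one> \<oplus> d \<one> = d \<one> \<oplus> \<zero>" using deriv_mult[of \<one> \<one>] deriv_closed[of \<one>] by simp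
  then show ?thesis using deriv_closed by (metis add.l_cancel zero_closed one_closed)
qed

lemma deriv_funpow_one: "0 < k \<Longrightarrow> (d ^^ k) \<one> = \<zero>"
proof (induction k)
  case (Suc k)
  then show ?case by (cases k) (auto simp: deriv_one deriv_zero)
qed simp

lemma deriv_finsum:
  "f \<in> Y \<rightarrow> carrier R \<Longrightarrow> d (finsum R f Y) = (\<Oplus>x\<in>Y. d (f x))"
  by (induction Y rule: infinite_finite_induct) (auto simp: deriv_zero deriv_add deriv_closed Pi_def)

lemma deriv_add_pow: "x \<in> carrier R \<Longrightarrow> d ([(n::nat)] \<cdot> x) = [n] \<cdot> d x"
  by (induction n) (auto simp: deriv_zero deriv_add deriv_closed add.nat_pow_Suc)

lemma deriv_funpow_mult:
  assumes x: "x \<in> carrier R" and y: "y \<in> carrier R"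
  shows "(d ^^ k) (x \<otimes> y) = (\<Oplus>r\<in>{..k}. [(k choose r)] \<cdot> ((d ^^ r) x \<otimes> (d ^^ (k - r)) y))"
proof (induction k)
  case 0
  then show ?case using x y by simp
next
  case (Suc k)
  let ?p = "\<lambda>r s. (d ^^ r) x \<otimes> (d ^^ s) y"
  have [simp]: "(d ^^ r) x \<in> carrier R" "(d ^^ r) y \<in> carrier R"
    "d ((d ^^ r) x) \<in> carrier R" "d ((d ^^ r) y) \<in> carrier R" for r
    using x y by (simp_all add: deriv_funpow_closed deriv_closed)
  let ?A = "\<lambda>r. [(k choose r)] \<cdot> ?p (Suc r) (k - r)"
  let ?B = "\<lambda>r. [(k choose r)] \<cdot> ?p r (Suc k - r)"
  have "(d ^^ Suc k) (x \<otimes> y) = (\<Oplus>r\<in>{..k}. d ([(k choose r)] \<cdot> ?p r (k - r)))"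
    by (simp add: Suc deriv_finsum)
  also have "\<dots> = (\<Oplus>r\<in>{..k}. ?A r \<oplus> ?B r)"
    using x y by (intro finsum_cong')
      (auto simp: deriv_add_pow deriv_mult deriv_closed deriv_funpow_closed add.nat_pow_distrib Suc_diff_le)
  also have "\<dots> = (\<Oplus>r\<in>{..k}. ?A r) \<oplus> (\<Oplus>r\<in>{..k}. ?B r)"
    by (rule finsum_addf) auto
  \<comment> \<open>The extra term has coefficient \<open>k choose Suc k\<close>, which is 0. It
    allows splitting off \<open>?B 0\<close> and pairing the rest by Pascal's rule.\<close>
  also have "(\<Oplus>r\<in>{..k}. ?B r) = (\<Oplus>r\<in>{..Suc k}. ?B r)"
    by (simp add: finsum_Suc binomial_eq_0)
  also have "\<dots> = (\<Oplus>r\<in>{..k}. ?B (Suc r)) \<oplus> ?B 0"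
    by (rule finsum_Suc2) auto
  also have "(\<Oplus>r\<in>{..k}. ?A r) \<oplus> ((\<Oplus>r\<in>{..k}. ?B (Suc r)) \<oplus> ?B 0) = (\<Oplus>r\<in>{..k}. ?A r \<oplus> ?B (Suc r)) \<oplus> ?B 0"
    using x y by (simp add: finsum_addf a_assoc Pi_def)
  also have "(\<Oplus>r\<in>{..k}. ?A r \<oplus> ?B (Suc r)) = (\<Oplus>r\<in>{..k}. [(Suc k choose Suc r)] \<cdot> ?p (Suc r) (Suc k - Suc r))"
    by (intro finsum_cong') (auto simp: add.nat_pow_mult)
  also have "\<dots> \<oplus> ?B 0 = (\<Oplus>r\<in>{..Suc k}. [(Suc k choose r)] \<cdot> ?p r (Suc k - r))"
    by (subst finsum_Suc2) auto
  finally show ?case .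
qed

text \<open>Dividing by the factorial removes the binomial coefficients from the Leibniz rule. The
  inverse is meaningful where factorials are units, as \<open>rational_differential_ring\<close>
  ensures.\<close>

definition dpow :: "nat \<Rightarrow> 'a \<Rightarrow> 'a"
  where "dpow k a = inv ([(fact k :: nat)] \<cdot> \<one>) \<otimes> (d ^^ k) a"

end

text \<open>Differential algebras over the rationals, including the zero ring. This is the form in
  which characteristic zero of \<open>K\<close> is used.\<close>

locale rational_differential_ring = differential_ring +
  assumes nat_unit: "0 < (m::nat) \<Longrightarrow> [m] \<cdot> \<one> \<in> Units R"
begin

lemma fact_unit: "[(fact k :: nat)] \<cdot> \<one> \<in> Units R"
  by (rule nat_unit) simp

lemma dpow_closed: "a \<in> carrier R \<Longrightarrow> dpow k a \<in> carrier R"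
  by (simp add: dpow_def fact_unit deriv_funpow_closed)

lemma deriv_funpow_eq_dpow: "a \<in> carrier R \<Longrightarrow> (d ^^ k) a = ([(fact k :: nat)] \<cdot> \<one>) \<otimes> dpow k a"
  using fact_unit[of k] by (simp add: dpow_def deriv_funpow_closed flip: m_assoc)

text \<open>After multiplication by the unit \<open>k!\<close> this becomes the ordinary Leibniz
  rule, because \<open>k! = (k choose r) * r! * (k - r)!\<close>.\<close>

lemma dpow_mult:
  assumes x: "x \<in> carrier R" and y: "y \<in> carrier R"
  shows "dpow k (x \<otimes> y) = (\<Oplus>r\<in>{..k}. dpow r x \<otimes> dpow (k - r) y)"
proof -
  let ?u = "\<lambda>k. [(fact k :: nat)] \<cdot> \<one>"
  have u [simp]: "?u k \<in> carrier R" "inv (?u k) \<in> carrier R" for k using fact_unit by auto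
  have "?u k \<otimes> (\<Oplus>r\<in>{..k}. dpow r x \<otimes> dpow (k - r) y) = (\<Oplus>r\<in>{..k}. ?u k \<otimes> (dpow r x \<otimes> dpow (k - r) y))"
    using x y by (intro finsum_rdistr) (auto simp: dpow_closed)
  also have "\<dots> = (\<Oplus>r\<in>{..k}. [(k choose r)] \<cdot> ((d ^^ r) x \<otimes> (d ^^ (k - r)) y))"
  proof (intro finsum_cong')
    fix r assume "r \<in> {..k}"
    then have "fact k = (k choose r) * (fact r * fact (k - r)) "
      using binomial_fact_lemma[of r k] by (simp add: mult_ac)
    then have "?u k = [(k choose r)] \<cdot> (?u r \<otimes> ?u (k - r))"
      by (simp add: add_pow_ldistr add_pow_rdistr add.nat_pow_pow mult_ac)
    moreover have "(?u r \<otimes> ?u (k - r)) \<otimes> (dpow r x \<otimes> dpow (k - r) y) = (?u r \<otimes> dpow r x) \<otimes> (?u (k - r) \<otimes> dpow (k - r) y)"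
      using x y by (simp add: dpow_closed m_ac del: add_pow_ldistr add_pow_rdistr)
    ultimately show "?u k \<otimes> (dpow r x \<otimes> dpow (k - r) y) = [(k choose r)] \<cdot> ((d ^^ r) x \<otimes> (d ^^ (k - r)) y)"
      using x y by (simp add: add_pow_ldistr dpow_closed deriv_funpow_eq_dpow)
  qed (use x y in \<open>auto simp: deriv_funpow_closed\<close>)
  also have "\<dots> = ?u k \<otimes> dpow k (x \<otimes> y)"
    using x y by (simp add: deriv_funpow_eq_dpow[symmetric] deriv_funpow_mult)
  finally show ?thesis
    using x y fact_unit[of k] by (subst (asm) Units_l_cancel) (auto simp: dpow_closed)
qed

end

section \<open>Evaluating monomials in the ring\<close>

lemma sum_compositions_insert:
  fixes f :: "('i \<Rightarrow> nat) \<Rightarrow> 'b::comm_monoid_add"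
  assumes Y: "finite Y" "i \<notin> Y"
  shows "sum f (compositions (insert i Y) k) = (\<Sum>r\<le>k. \<Sum>b\<in>compositions Y (k - r). f (b(i := r)))"
proof -
  have "(\<Sum>r\<le>k. \<Sum>b\<in>compositions Y (k - r). f (b(i := r))) =
      (\<Sum>(r, b)\<in>Sigma {..k} (\<lambda>r. compositions Y (k - r)). f (b(i := r)))"
    by (rule sum.Sigma) (auto simp: finite_compositions Y)
  also have "\<dots> = sum f (compositions (insert i Y) k)"
  \<comment> \<open>Resetting \<open>b\<close> to \<open>undefined\<close> at \<open>i\<close> makes
    it extensional on \<open>Y\<close> again, so that the two maps are inverse to each
    other.\<close>
  proof (rule sum.reindex_bij_witness[where i = "\<lambda>b. (b i, b(i := undefined))" and j = "\<lambda>(r, b). b(i := r)"])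
    fix p assume "p \<in> Sigma {..k} (\<lambda>r. compositions Y (k - r))"
    then obtain r b where p: "p = (r, b)" and r: "r \<le> k" and b: "b \<in> Y \<rightarrow>\<^sub>E {..k - r}" "sum b Y = k - r"
      by (auto simp: compositions_def)
    have "b i = undefined" using b Y by (auto simp: PiE_def extensional_def)
    then show "(\<lambda>b. (b i, b(i := undefined))) ((\<lambda>(r, b). b(i := r)) p) = p"
      by (auto simp: p fun_upd_idem)
    have "sum (b(i := r)) Y = sum b Y" using Y by (intro sum.cong) auto
    then have "sum (b(i := r)) (insert i Y) = k" using Y b r by simp
    moreover have "b(i := r) \<in> insert i Y \<rightarrow>\<^sub>E {..k}"
      using b r by (auto simp: PiE_def extensional_def Pi_def intro: order.trans)
    ultimately show "(\<lambda>(r, b). b(i := r)) p \<in> compositions (insert i Y) k"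
      by (simp add: p compositions_def)
  next
    fix b assume "b \<in> compositions (insert i Y) k"
    then have b: "b \<in> insert i Y \<rightarrow>\<^sub>E {..k}" "b i + sum b Y = k" using Y by (auto simp: compositions_def)
    have s: "sum (b(i := undefined)) Y = sum b Y" using Y by (intro sum.cong) auto
    have "b l \<le> k - b i" if "l \<in> Y" for l
      using member_le_sum[of l Y b] that Y b(2) by simp
    then show "(b i, b(i := undefined)) \<in> Sigma {..k} (\<lambda>r. compositions Y (k - r))"
      using b Y s by (auto simp: compositions_def PiE_def extensional_def)
  qed auto
  finally show ?thesis by simp
qed

context rational_differential_ring
begin

text \<open>Entries of the determinants can have negative index; the value zero there is what
  \<open>negative_G\<close> asks for.\<close>

definition dpow_int :: "int \<Rightarrow> 'a \<Rightarrow> 'a"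
  where "dpow_int k a = (if k < 0 then \<zero> else dpow (nat k) a)"

lemma dpow_int_closed: "a \<in> carrier R \<Longrightarrow> dpow_int k a \<in> carrier R"
  by (simp add: dpow_int_def dpow_closed)

lemma dpow_one: "dpow k \<one> = (if k = 0 then \<one> else \<zero>)"
  using fact_unit[of k] by (auto simp: dpow_def deriv_funpow_one)

lemma additive_sum:
  assumes add: "\<And>x y. \<Phi> (x + y) = \<Phi> x \<oplus> \<Phi> y" and closed: "\<And>x. \<Phi> x \<in> carrier R"
    and Y: "finite Y"
  shows "\<Phi> (\<Sum>x\<in>Y. f x) = (\<Oplus>x\<in>Y. \<Phi> (f x))"
proof -
  have zero: "\<Phi> 0 = \<zero>"
  proof -
    have "\<Phi> 0 \<oplus> \<Phi> 0 = \<Phi> 0 \<oplus> \<zero>" using add[of 0 0] closed[of 0] by simp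
    then show ?thesis using closed by (metis add.l_cancel zero_closed)
  qed
  show ?thesis using Y by (induction Y) (auto simp: zero add closed)
qed

text \<open>The Leibniz rule for a product of many factors. The chosen labels run over a subset
  \<open>Y\<close> so that they can be added one by one; the remaining labels form a factor that is
  carried along.\<close>

lemma leibniz_monomials:
  fixes \<Phi> :: "(('i \<times> nat \<Rightarrow> int) \<Rightarrow>\<^sub>0 int) \<Rightarrow> 'a" and a :: "'i \<times> nat \<Rightarrow> 'a"
  assumes add: "\<And>x y. \<Phi> (x + y) = \<Phi> x \<oplus> \<Phi> y" and closed: "\<And>x. \<Phi> x \<in> carrier R"
    and \<Phi>: "\<And>j. \<Phi> (frag_of j) = (\<Otimes>l\<in>I \<times> {..<N}. dpow_int (j l) (a l))"
    and a: "\<And>l. l \<in> I \<times> {..<N} \<Longrightarrow> a l \<in> carrier R"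
    and I: "finite I"
    and \<tau>: "\<tau> \<in> I \<rightarrow> {..<N}"
    and Y: "Y \<subseteq> I"
  shows "\<Phi> (\<Sum>b\<in>compositions Y k. frag_of (\<lambda>(i, t). if i \<in> Y \<and> t = \<tau> i then int (b i) else j (i, t)))
    = dpow k (\<Otimes>i\<in>Y. a (i, \<tau> i)) \<otimes>
      (\<Otimes>l\<in>I \<times> {..<N} - (\<lambda>i. (i, \<tau> i)) ` Y. dpow_int (j l) (a l))"
proof -
  define L where "L = I \<times> {..<N}"
  have L: "finite L" using I by (simp add: L_def)
  have a': "a l \<in> carrier R" if "l \<in> L" for l using a that by (simp add: L_def)
  have fX: "finite Y" using Y I finite_subset by blast
  have "\<Phi> (\<Sum>b\<in>compositions Y k. frag_of (\<lambda>(i, t). if i \<in> Y \<and> t = \<tau> i then int (b i) else j (i, t)))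
    = dpow k (\<Otimes>i\<in>Y. a (i, \<tau> i)) \<otimes>
      (\<Otimes>l\<in>L - (\<lambda>i. (i, \<tau> i)) ` Y. dpow_int (j l) (a l))"
    using fX Y
  proof (induction Y arbitrary: j k rule: finite_induct)
    case empty
    \<comment> \<open>Over the empty set only \<open>k = 0\<close> has a composition, matching
      \<open>dpow k \<one> = \<zero>\<close> for \<open>k > 0\<close>.\<close>
    have "compositions ({} :: 'i set) k = (if k = 0 then {\<lambda>_. undefined} else {})" for k
      by (auto simp: compositions_def)
    moreover have "\<Phi> 0 = \<zero>" using additive_sum[of \<Phi> "{}"] add closed by simp
    moreover have "(\<Otimes>l\<in>L. dpow_int (j l) (a l)) \<in> carrier R"
      using a' by (auto simp: dpow_int_closed)
    ultimately show ?case using \<Phi>[of j] by (auto simp: dpow_one L_def)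
  next
    case (insert i Y)
    then have i: "i \<in> I" "i \<notin> Y" "Y \<subseteq> I" by auto
    then have i\<tau>: "(i, \<tau> i) \<in> L" using \<tau> by (auto simp: L_def)
    define B where "B = L - (\<lambda>i. (i, \<tau> i)) ` insert i Y"
    have B: "L - (\<lambda>i. (i, \<tau> i)) ` Y = insert (i, \<tau> i) B" "(i, \<tau> i) \<notin> B" "B \<subseteq> L" "finite B"
      using i i\<tau> L by (auto simp: B_def)
    have aB: "a l \<in> carrier R" if "l \<in> B" for l
      using a' B(3) that by blast
    define rest where "rest = (\<Otimes>l\<in>B. dpow_int (j l) (a l))"
    have rest: "rest \<in> carrier R" unfolding rest_def using aB by (intro finprod_closed) (simp add: dpow_int_closed Pi_def)
    have aX: "(\<Otimes>i\<in>Y. a (i, \<tau> i)) \<in> carrier R"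
      using a \<tau> i by (intro finprod_closed) (auto simp: Pi_def)
    \<comment> \<open>The order \<open>r\<close> of the new label is written into \<open>j\<close>,
      so that the induction hypothesis covers the labels of \<open>Y\<close> with this changed
      \<open>j\<close>.\<close>
    let ?j = "\<lambda>r. j((i, \<tau> i) := int r)"
    have upd: "(\<lambda>(i', t). if i' \<in> insert i Y \<and> t = \<tau> i' then int ((b(i := r)) i') else j (i', t))
       = (\<lambda>(i', t). if i' \<in> Y \<and> t = \<tau> i' then int (b i') else ?j r (i', t))" for b r
      using i by (auto simp: fun_eq_iff)
    have prod: "(\<Otimes>l\<in>insert (i, \<tau> i) B. dpow_int (?j r l) (a l)) = dpow r (a (i, \<tau> i)) \<otimes> rest" for r
    proof -
      have "(\<Otimes>l\<in>B. dpow_int (?j r l) (a l)) = rest"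
        unfolding rest_def using B(2) aB by (intro finprod_cong') (auto simp: dpow_int_closed)
      then show ?thesis
        using B(2,4) aB a'[OF i\<tau>]
        by (subst finprod_insert) (simp_all add: dpow_int_closed dpow_closed dpow_int_def[of "int r"] Pi_def)
    qed
    have "\<Phi> (\<Sum>b\<in>compositions (insert i Y) k. frag_of (\<lambda>(i', t). if i' \<in> insert i Y \<and> t = \<tau> i' then int (b i') else j (i', t)))
      = (\<Oplus>r\<in>{..k}. \<Phi> (\<Sum>b\<in>compositions Y (k - r). frag_of
          (\<lambda>(i', t). if i' \<in> Y \<and> t = \<tau> i' then int (b i') else ?j r (i', t))))"
      unfolding sum_compositions_insert[OF insert(1,2)] upd
      by (rule additive_sum) (auto simp: add closed)
    also have "\<dots> = (\<Oplus>r\<in>{..k}. dpow (k - r) (\<Otimes>i\<in>Y. a (i, \<tau> i)) \<otimes> (dpow r (a (i, \<tau> i)) \<otimes> rest))"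
      unfolding insert.IH[OF i(3)] B(1) prod using aX rest a'[OF i\<tau>]
      by (intro finsum_cong') (auto simp: dpow_closed)
    also have "\<dots> = (\<Oplus>r\<in>{..k}. (dpow r (a (i, \<tau> i)) \<otimes> dpow (k - r) (\<Otimes>i\<in>Y. a (i, \<tau> i))) \<otimes> rest)"
      using aX rest a'[OF i\<tau>] by (intro finsum_cong') (auto simp: dpow_closed m_ac)
    also have "\<dots> = dpow k (a (i, \<tau> i) \<otimes> (\<Otimes>i\<in>Y. a (i, \<tau> i))) \<otimes> rest"
      using aX rest a'[OF i\<tau>] by (subst finsum_ldistr[symmetric]) (auto simp: dpow_closed dpow_mult)
    also have "a (i, \<tau> i) \<otimes> (\<Otimes>i\<in>Y. a (i, \<tau> i)) = (\<Otimes>i\<in>insert i Y. a (i, \<tau> i))"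
      using a \<tau> i insert(1) by (subst finprod_insert) (auto simp: Pi_def)
    finally show ?case unfolding rest_def B_def .
  qed
  then show ?thesis by (simp add: L_def)
qed

text \<open>Straightening is transported along the additive map \<open>\<Phi>\<close> that evaluates
  monomials: the integer combinations with value in \<open>J\<close> satisfy
  \<open>arc_relations\<close>.\<close>

theorem finprod_derivs_mem:
  fixes a :: "'i \<times> nat \<Rightarrow> 'a"
  assumes J: "ideal J R" and I: "finite I" "I \<noteq> {}" and H: "H = (\<Sum>i\<in>I. h i)"
    and N: "\<And>i. i \<in> I \<Longrightarrow> (h i + 1) * (H - h i) < N"
    and a: "a \<in> I \<times> {..<N} \<rightarrow> carrier R"
    and mem: "\<And>\<tau> k. \<tau> \<in> I \<rightarrow> {..<N} \<Longrightarrow> k \<le> H \<Longrightarrow> (d ^^ k) (\<Otimes>i\<in>I. a (i, \<tau> i)) \<in> J"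
    and e: "\<And>i t. i \<in> I \<Longrightarrow> t < N \<Longrightarrow> e (i, t) \<le> h i"
  shows "(\<Otimes>l\<in>I \<times> {..<N}. (d ^^ e l) (a l)) \<in> J"
proof -
  interpret J: ideal J R by fact
  have a_carr: "a (i, t) \<in> carrier R" if "i \<in> I" "t < N" for i t
    using a that by auto
  define m where "m j = (\<Otimes>l\<in>I \<times> {..<N}. dpow_int (j l) (a l))" for j
  have m_closed: "m j \<in> carrier R" for j
    unfolding m_def using a_carr by (intro finprod_closed) (auto simp: dpow_int_closed)
  obtain \<Phi> where \<Phi>: "\<Phi> \<in> hom (free_Abelian_group UNIV) (add_monoid R)" "\<And>j. \<Phi> (frag_of j) = m j"
    using add.free_Abelian_group_universal[of m UNIV] m_closed by auto
  have add: "\<Phi> (x + y) = \<Phi> x \<oplus> \<Phi> y" and closed: "\<Phi> x \<in> carrier R" for x y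
    using \<Phi>(1) by (auto simp: hom_def Pi_def)
  have \<Phi>_0: "\<Phi> 0 = \<zero>" using additive_sum[of \<Phi> "{}"] add closed by simp
  have \<Phi>_minus: "\<Phi> (- x) = \<ominus> \<Phi> x" for x
    using add[of "- x" x] \<Phi>_0 closed by (intro minus_equality[symmetric]) auto
  interpret arc_relations I h H N "{x. \<Phi> x \<in> J}"
  proof
    show "0 \<in> {x. \<Phi> x \<in> J}" by (simp add: \<Phi>_0)
    show "x + y \<in> {x. \<Phi> x \<in> J}" if "x \<in> {x. \<Phi> x \<in> J}" "y \<in> {x. \<Phi> x \<in> J}" for x y
      using that by (simp add: add)
    show "- x \<in> {x. \<Phi> x \<in> J}" if "x \<in> {x. \<Phi> x \<in> J}" for x
      using that by (simp add: \<Phi>_minus)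
    show "frag_of j \<in> {x. \<Phi> x \<in> J}" if "i \<in> I" "t < N" "j (i, t) < 0" for i t j
    proof -
      have eq: "I \<times> {..<N} = insert (i, t) (I \<times> {..<N} - {(i, t)})" using that by auto
      have "m j = dpow_int (j (i, t)) (a (i, t)) \<otimes> (\<Otimes>l\<in>I \<times> {..<N} - {(i, t)}. dpow_int (j l) (a l))"
        unfolding m_def using that a_carr I
        by (subst eq, subst finprod_insert) (auto simp: dpow_int_closed Pi_def)
      also have "\<dots> = \<zero>"
        using that a_carr by (simp add: dpow_int_def[of "j (i, t)"] finprod_closed dpow_int_closed Pi_def)
      finally show ?thesis by (simp add: \<Phi>)
    qed
    show "(\<Sum>b\<in>compositions I k. frag_of (\<lambda>(i, t). if i \<in> I \<and> t = \<tau> i then int (b i) else j (i, t)))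
        \<in> {x. \<Phi> x \<in> J}" if \<tau>: "\<tau> \<in> I \<rightarrow> {..<N}" and k: "k \<le> H" for \<tau> k j
    proof -
      have "dpow k (\<Otimes>i\<in>I. a (i, \<tau> i)) \<in> J"
        using mem[OF that] fact_unit[of k] by (auto simp: dpow_def intro!: J.I_l_closed)
      moreover have "(\<Otimes>l\<in>I \<times> {..<N} - (\<lambda>i. (i, \<tau> i)) ` I. dpow_int (j l) (a l)) \<in> carrier R"
        using a_carr by (intro finprod_closed) (auto simp: dpow_int_closed)
      moreover have "\<Phi> (\<Sum>b\<in>compositions I k. frag_of (\<lambda>(i, t). if i \<in> I \<and> t = \<tau> i then int (b i) else j (i, t)))
        = dpow k (\<Otimes>i\<in>I. a (i, \<tau> i)) \<otimes>
          (\<Otimes>l\<in>I \<times> {..<N} - (\<lambda>i. (i, \<tau> i)) ` I. dpow_int (j l) (a l))"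
        using a_carr by (intro leibniz_monomials[OF add closed]) (auto simp: \<Phi>(2) m_def I \<tau>)
      ultimately show ?thesis by (simp add: J.I_r_closed)
    qed
  qed (use I H N in auto)
  have "frag_of (\<lambda>l. int (e l)) \<in> {x. \<Phi> x \<in> J}"
  proof (rule frag_of_G)
    fix i assume "i \<in> I"
    then show "(\<Sum>t<N. int (e (i, t))) \<le> int (N * h i)"
      using sum_bounded_above[of "{..<N}" "\<lambda>t. int (e (i, t))" "int (h i)"] e by simp
  qed
  then have m_mem: "m (\<lambda>l. int (e l)) \<in> J" by (simp add: \<Phi>)
  \<comment> \<open>Passing back from divided powers costs a product of factorials, which the ideal
    \<open>J\<close> absorbs.\<close>
  have "(\<Otimes>l\<in>I \<times> {..<N}. (d ^^ e l) (a l)) =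
      (\<Otimes>l\<in>I \<times> {..<N}. ([(fact (e l) :: nat)] \<cdot> \<one>) \<otimes> dpow_int (int (e l)) (a l))"
    using a_carr by (intro finprod_cong') (auto simp: dpow_int_def deriv_funpow_eq_dpow dpow_closed Pi_def simp del: add_pow_ldistr)
  also have "\<dots> = (\<Otimes>l\<in>I \<times> {..<N}. [(fact (e l) :: nat)] \<cdot> \<one>) \<otimes> m (\<lambda>l. int (e l))"
    unfolding m_def using a_carr by (intro finprod_multf) (auto simp: dpow_int_closed)
  finally show ?thesis using m_mem by (auto intro!: J.I_l_closed finprod_closed)
qed

end

section \<open>Products of ideals given by generators\<close>

context cring
begin

text \<open>The colon ideal of \<open>J\<close> by \<open>T\<close>. Being an ideal, it contains a
  generated ideal as soon as it contains the generators.\<close>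

lemma ideal_colon:
  assumes J: "ideal J R" and T: "T \<subseteq> carrier R"
  shows "ideal {x \<in> carrier R. \<forall>t\<in>T. x \<otimes> t \<in> J} R" (is "ideal ?C R")
proof (rule idealI)
  interpret J: ideal J R by fact
  have T': "t \<in> carrier R" if "t \<in> T" for t using T that by blast
  show "ring R" by (rule ring_axioms)
  show "subgroup ?C (add_monoid R)"
    by (rule subgroup.intro) (auto simp: T' l_distr l_minus simp flip: a_inv_def)
  show "x \<otimes> c \<in> ?C" "c \<otimes> x \<in> ?C" if "c \<in> ?C" "x \<in> carrier R" for c x
  proof -
    have "(x \<otimes> c) \<otimes> t \<in> J" if "t \<in> T" for t
      using \<open>c \<in> ?C\<close> \<open>x \<in> carrier R\<close> that by (simp add: m_assoc T' J.I_l_closed)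
    then show "x \<otimes> c \<in> ?C" using that by simp
    then show "c \<otimes> x \<in> ?C" using that by (simp add: m_comm)
  qed
qed

text \<open>Colon ideals reduce one factor at a time to generators: first \<open>Idl S\<close>
  against \<open>T\<close>, then \<open>Idl T\<close> against \<open>Idl S\<close>.\<close>

lemma genideal_prod_subset:
  assumes S: "S \<subseteq> carrier R" and T: "T \<subseteq> carrier R" and J: "ideal J R"
    and ST: "\<And>s t. s \<in> S \<Longrightarrow> t \<in> T \<Longrightarrow> s \<otimes> t \<in> J"
  shows "ideal_prod R (Idl S) (Idl T) \<subseteq> J"
proof
  interpret J: ideal J R by fact
  have IdlS: "Idl S \<subseteq> carrier R"
    using ideal.Icarr[OF genideal_ideal[OF S]] by blast
  have left: "Idl S \<subseteq> {x \<in> carrier R. \<forall>t\<in>T. x \<otimes> t \<in> J}"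
    using S ST by (intro genideal_minimal ideal_colon J T) auto
  have "Idl T \<subseteq> {y \<in> carrier R. \<forall>x\<in>Idl S. y \<otimes> x \<in> J}"
  proof (rule genideal_minimal[OF ideal_colon[OF J IdlS]], intro subsetI CollectI conjI ballI)
    fix t x assume t: "t \<in> T" and x: "x \<in> Idl S"
    then have "x \<otimes> t \<in> J" "x \<in> carrier R" "t \<in> carrier R" using left T by auto
    then show "t \<otimes> x \<in> J" by (simp add: m_comm)
  qed (use T in auto)
  then have prod: "x \<otimes> y \<in> J" if "x \<in> Idl S" "y \<in> Idl T" for x y
    using that IdlS by (auto simp: m_comm subset_iff)
  fix z assume "z \<in> ideal_prod R (Idl S) (Idl T)"
  then show "z \<in> J" by induction (auto simp: prod)
qed

lemma ideal_prod_mono: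
  assumes "I \<subseteq> I'" "J \<subseteq> J'"
  shows "ideal_prod R I J \<subseteq> ideal_prod R I' J'"
proof
  fix z assume "z \<in> ideal_prod R I J"
  then show "z \<in> ideal_prod R I' J'"
    by induction (use assms in \<open>auto intro: ideal_prod.intros\<close>)
qed

lemma carrier_ideals_set: "carrier (ideals_set R) = {I. ideal I R}"
  and mult_ideals_set: "I \<otimes>\<^bsub>ideals_set R\<^esub> J = ideal_prod R I J"
  and one_ideals_set: "\<one>\<^bsub>ideals_set R\<^esub> = carrier R"
  by (simp_all add: ideals_set_def)

lemma finprod_mem_finprod_ideals:
  assumes "finite S" "\<And>i. i \<in> S \<Longrightarrow> ideal (J i) R" "\<And>i. i \<in> S \<Longrightarrow> x i \<in> J i"
  shows "(\<Otimes>i\<in>S. x i) \<in> (\<Otimes>\<^bsub>ideals_set R\<^esub>i\<in>S. J i)"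
proof -
  interpret M: comm_monoid "ideals_set R" by (rule ideals_set_is_comm_monoid)
  show ?thesis using assms
  proof (induction S rule: finite_induct)
    case empty
    then show ?case by (simp add: one_ideals_set)
  next
    case (insert i S)
    then have "x l \<in> carrier R" if "l \<in> insert i S" for l
      using that by (blast intro: ideal.Icarr)
    then show ?case
      using insert by (auto simp: Pi_def carrier_ideals_set mult_ideals_set intro!: ideal_prod.prod)
  qed
qed

text \<open>The second component of a label only numbers copies of the same set, so that powers are
  covered along with products: \<open>I \<times> {..<N}\<close> stands for an \<open>N\<close>-th
  power.\<close>

definition choice_prods :: "('i \<Rightarrow> 'a set) \<Rightarrow> ('i \<times> nat) set \<Rightarrow> 'a set"
  where "choice_prods S L = {\<Otimes>l\<in>L. f l | f. f \<in> (\<Pi> l\<in>L. S (fst l))}"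

lemma choice_prods_subset:
  assumes "\<And>l. l \<in> L \<Longrightarrow> S (fst l) \<subseteq> carrier R"
  shows "choice_prods S L \<subseteq> carrier R"
  using assms by (auto simp: choice_prods_def intro!: finprod_closed)

lemma choice_prods_Un:
  assumes L: "finite L" "finite M" "L \<inter> M = {}"
    and S: "\<And>l. l \<in> L \<union> M \<Longrightarrow> S (fst l) \<subseteq> carrier R"
  shows "ideal_prod R (Idl (choice_prods S L)) (Idl (choice_prods S M)) \<subseteq> Idl (choice_prods S (L \<union> M))"
proof (rule genideal_prod_subset)
  show "choice_prods S L \<subseteq> carrier R" "choice_prods S M \<subseteq> carrier R"
    using S by (auto intro!: choice_prods_subset)
  have LM: "choice_prods S (L \<union> M) \<subseteq> carrier R"
    using S by (rule choice_prods_subset)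
  then show "ideal (Idl (choice_prods S (L \<union> M))) R" by (rule genideal_ideal)
  fix s t assume "s \<in> choice_prods S L" "t \<in> choice_prods S M"
  then obtain f g where f: "s = (\<Otimes>l\<in>L. f l)" "f \<in> (\<Pi> l\<in>L. S (fst l))"
    and g: "t = (\<Otimes>l\<in>M. g l)" "g \<in> (\<Pi> l\<in>M. S (fst l))"
    by (auto simp: choice_prods_def)
  define F where "F l = (if l \<in> L then f l else g l)" for l
  have carr: "f l \<in> carrier R" if "l \<in> L" for l using f(2) S that by blast
  have carr': "g l \<in> carrier R" if "l \<in> M" for l using g(2) S that by blast
  have "s = (\<Otimes>l\<in>L. F l)" unfolding f(1) using carr by (intro finprod_cong') (auto simp: F_def)
  moreover have "t = (\<Otimes>l\<in>M. F l)" unfolding g(1) using carr' L by (intro finprod_cong') (auto simp: F_def)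
  moreover have "(\<Otimes>l\<in>L \<union> M. F l) = (\<Otimes>l\<in>L. F l) \<otimes> (\<Otimes>l\<in>M. F l)"
    using carr carr' L by (intro finprod_Un_disjoint) (auto simp: F_def)
  moreover have "F \<in> (\<Pi> l\<in>L \<union> M. S (fst l))" using f(2) g(2) by (simp add: F_def Pi_def)
  ultimately have "s \<otimes> t \<in> choice_prods S (L \<union> M)"
    unfolding choice_prods_def by (intro CollectI exI[of _ F]) simp
  then show "s \<otimes> t \<in> Idl (choice_prods S (L \<union> M))"
    using genideal_self[OF LM] by blast
qed

text \<open>Two inductions: over \<open>I\<close> for a single factor of the power, whose labels
  form the row \<open>I \<times> {t}\<close>, then over \<open>N\<close>, joining one more row at
  each step.\<close>

lemma pow_finprod_genideal_subset:
  assumes I: "finite I" and S: "\<And>i. i \<in> I \<Longrightarrow> S i \<subseteq> carrier R"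
  shows "(\<Otimes>\<^bsub>ideals_set R\<^esub>i\<in>I. Idl (S i)) [^]\<^bsub>ideals_set R\<^esub> (N :: nat)
    \<subseteq> Idl (choice_prods S (I \<times> {..<N}))"
proof -
  interpret M: comm_monoid "ideals_set R" by (rule ideals_set_is_comm_monoid)
  \<comment> \<open>Both inductions start from the unit ideal, since the empty product is
    \<open>\<one>\<close>.\<close>
  have empty: "carrier R \<subseteq> Idl (choice_prods S {})"
  proof -
    have "\<one> \<in> Idl (choice_prods S {})"
      using genideal_self[of "choice_prods S {}"] by (auto simp: choice_prods_def)
    then show ?thesis
      using genideal_ideal[of "choice_prods S {}"] choice_prods_subset[of "{}" S]
      by (metis empty_iff ideal.one_imp_carrier order_refl)
  qed
  have row: "(\<Otimes>\<^bsub>ideals_set R\<^esub>i\<in>I. Idl (S i)) \<subseteq> Idl (choice_prods S (I \<times> {t}))" for t :: nat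
    using I S
  proof (induction I rule: finite_induct)
    case empty
    then show ?case using \<open>carrier R \<subseteq> _\<close> by (simp add: one_ideals_set)
  next
    case (insert i I)
    have "S i \<subseteq> choice_prods S {(i, t)}"
    proof
      fix s assume s: "s \<in> S i"
      then have "(\<Otimes>l\<in>{(i, t)}. s) = s"
        using insert.prems[of i] by (subst finprod_insert) auto
      then show "s \<in> choice_prods S {(i, t)}"
        using s by (auto simp: choice_prods_def intro!: exI[of _ "\<lambda>_. s"])
    qed
    then have Si: "Idl (S i) \<subseteq> Idl (choice_prods S {(i, t)})"
      using insert.prems by (intro subset_Idl_subset choice_prods_subset) auto
    have "(\<Otimes>\<^bsub>ideals_set R\<^esub>i\<in>insert i I. Idl (S i)) = ideal_prod R (Idl (S i)) (\<Otimes>\<^bsub>ideals_set R\<^esub>i\<in>I. Idl (S i))"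
      using insert by (subst M.finprod_insert) (auto simp: carrier_ideals_set mult_ideals_set genideal_ideal)
    also have "\<dots> \<subseteq> ideal_prod R (Idl (choice_prods S {(i, t)})) (Idl (choice_prods S (I \<times> {t})))"
      using insert by (intro ideal_prod_mono Si) auto
    also have "\<dots> \<subseteq> Idl (choice_prods S ({(i, t)} \<union> I \<times> {t}))"
      using insert.hyps by (intro choice_prods_Un) (auto intro: subsetD[OF insert.prems])
    finally show ?case by simp
  qed
  show ?thesis
  proof (induction N)
    case 0
    then show ?case using empty by (simp add: one_ideals_set)
  next
    case (Suc N)
    have "(\<Otimes>\<^bsub>ideals_set R\<^esub>i\<in>I. Idl (S i)) [^]\<^bsub>ideals_set R\<^esub> Suc N
      \<subseteq> ideal_prod R (Idl (choice_prods S (I \<times> {..<N}))) (Idl (choice_prods S (I \<times> {N})))"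
      by (simp add: mult_ideals_set) (intro ideal_prod_mono Suc row)
    also have "\<dots> \<subseteq> Idl (choice_prods S (I \<times> {..<N} \<union> I \<times> {N}))"
      using I by (intro choice_prods_Un) (auto intro: subsetD[OF S])
    also have "I \<times> {..<N} \<union> I \<times> {N} = I \<times> {..<Suc N}" by auto
    finally show ?case .
  qed
qed

end

section \<open>Products of derivative ideals\<close>

text \<open>It suffices to treat products of derivatives with \<open>N\<close> factors from each
  ideal. Multiplying one underlying element per ideal gives a member of the product ideal, whose
  derivatives up to order \<open>H\<close> lie in \<open>?J\<close>; this is the input of
  \<open>finprod_derivs_mem\<close>.\<close>

theorem (in rational_differential_ring) pow_finprod_deriv_ideal_subset:
  fixes I :: "'i \<Rightarrow> 'a set"
  assumes S: "finite S" "S \<noteq> {}" and H: "H = (\<Sum>i\<in>S. h i)"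
    and N: "\<And>i. i \<in> S \<Longrightarrow> (h i + 1) * (H - h i) < N"
    and I: "\<And>i. i \<in> S \<Longrightarrow> ideal (I i) R"
  shows "(\<Otimes>\<^bsub>ideals_set R\<^esub>i\<in>S. deriv_ideal R d (I i) (h i)) [^]\<^bsub>ideals_set R\<^esub> N
    \<subseteq> deriv_ideal R d (\<Otimes>\<^bsub>ideals_set R\<^esub>i\<in>S. I i) H"
    (is "_ \<subseteq> ?J")
proof -
  interpret M: comm_monoid "ideals_set R" by (rule ideals_set_is_comm_monoid)
  define G where "G i = {(d ^^ j) a | j a. j \<le> h i \<and> a \<in> I i}" for i
  have I_carr: "a \<in> carrier R" if "i \<in> S" "a \<in> I i" for i a
    using I that by (blast intro: ideal.Icarr)
  have G: "G i \<subseteq> carrier R" if "i \<in> S" for i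
    using I_carr[OF that] by (auto simp: G_def deriv_funpow_closed)
  have prod_ideal: "ideal (\<Otimes>\<^bsub>ideals_set R\<^esub>i\<in>S. I i) R"
    using M.finprod_closed[of I S] I by (simp add: carrier_ideals_set Pi_def)
  have J: "ideal ?J R" by (rule deriv_ideal_is_ideal[OF prod_ideal])
  have gen: "{(d ^^ j) a | j a. j \<le> H \<and> a \<in> (\<Otimes>\<^bsub>ideals_set R\<^esub>i\<in>S. I i)} \<subseteq> ?J"
    unfolding deriv_ideal_def using ideal.Icarr[OF prod_ideal]
    by (intro genideal_self) (auto intro: deriv_funpow_closed)
  have "choice_prods G (S \<times> {..<N}) \<subseteq> ?J"
  proof
    fix x assume "x \<in> choice_prods G (S \<times> {..<N})"
    then obtain f where x: "x = (\<Otimes>l\<in>S \<times> {..<N}. f l)" and f: "\<And>l. l \<in> S \<times> {..<N} \<Longrightarrow> f l \<in> G (fst l)"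
      by (auto simp: choice_prods_def Pi_def)
    have "\<forall>l\<in>S \<times> {..<N}. \<exists>j a. f l = (d ^^ j) a \<and> j \<le> h (fst l) \<and> a \<in> I (fst l)"
      using f by (auto simp: G_def)
    then obtain e a where ea: "\<And>l. l \<in> S \<times> {..<N} \<Longrightarrow> f l = (d ^^ e l) (a l)"
      "\<And>l. l \<in> S \<times> {..<N} \<Longrightarrow> e l \<le> h (fst l)" "\<And>l. l \<in> S \<times> {..<N} \<Longrightarrow> a l \<in> I (fst l)"
      by metis
    have a: "a l \<in> carrier R" if "l \<in> S \<times> {..<N}" for l
      using I_carr[of "fst l"] ea(3)[OF that] that by auto
    have "x = (\<Otimes>l\<in>S \<times> {..<N}. (d ^^ e l) (a l))"
      unfolding x using ea(1) a by (intro finprod_cong') (auto simp: deriv_funpow_closed)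
    also have "\<dots> \<in> ?J"
    proof (rule finprod_derivs_mem[OF J S H N])
      show "a \<in> S \<times> {..<N} \<rightarrow> carrier R" using a by blast
      show "e (i, t) \<le> h i" if "i \<in> S" "t < N" for i t
        using ea(2)[of "(i, t)"] that by simp
      show "(d ^^ k) (\<Otimes>i\<in>S. a (i, \<tau> i)) \<in> ?J" if \<tau>: "\<tau> \<in> S \<rightarrow> {..<N}" and k: "k \<le> H" for \<tau> k
      proof -
        have "(\<Otimes>i\<in>S. a (i, \<tau> i)) \<in> (\<Otimes>\<^bsub>ideals_set R\<^esub>i\<in>S. I i)"
          using S(1) I
        proof (rule finprod_mem_finprod_ideals)
          show "a (i, \<tau> i) \<in> I i" if "i \<in> S" for i
            using ea(3)[of "(i, \<tau> i)"] \<tau> that by auto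
        qed
        then show ?thesis using gen k by blast
      qed
    qed
    finally show "x \<in> ?J" .
  qed
  then have "Idl (choice_prods G (S \<times> {..<N})) \<subseteq> ?J"
    by (rule genideal_minimal[OF J])
  moreover have "(\<Otimes>\<^bsub>ideals_set R\<^esub>i\<in>S. Idl (G i)) [^]\<^bsub>ideals_set R\<^esub> N \<subseteq> Idl (choice_prods G (S \<times> {..<N}))"
    using S(1) G by (rule pow_finprod_genideal_subset)
  ultimately show ?thesis by (auto simp: G_def deriv_ideal_def)
qed

section \<open>Inverses of integers in characteristic zero\<close>

lemma (in differential_algebra) rational_if_characteristic_zero:
  assumes "characteristic_zero K"
  shows "rational_differential_ring A dA"
proof
  fix m :: nat assume m: "0 < m"
  let ?K1 = "\<one>\<^bsub>K\<^esub>" and ?A1 = "\<one>\<^bsub>A\<^esub>"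
  \<comment> \<open>The integer \<open>m\<close> is inverted already in \<open>K\<close>; the
    structure map carries this inverse to \<open>A\<close>.\<close>
  define u where "u = [m] \<cdot>\<^bsub>K\<^esub> ?K1"
  have u: "u \<in> Units K"
    using assms m by (simp add: u_def characteristic_zero_def K.field_Units)
  then have u': "u \<in> carrier K" "inv\<^bsub>K\<^esub> u \<in> carrier K" by auto
  have "([k] \<cdot>\<^bsub>K\<^esub> ?K1) \<odot>\<^bsub>A\<^esub> ?A1 = [k] \<cdot>\<^bsub>A\<^esub> ?A1" for k :: nat
    by (induction k) (auto simp: smult_l_distr)
  then have m_eq: "[m] \<cdot>\<^bsub>A\<^esub> ?A1 = u \<odot>\<^bsub>A\<^esub> ?A1" by (simp add: u_def)
  have "(inv\<^bsub>K\<^esub> u \<odot>\<^bsub>A\<^esub> ?A1) \<otimes>\<^bsub>A\<^esub> (u \<odot>\<^bsub>A\<^esub> ?A1) = (inv\<^bsub>K\<^esub> u \<otimes>\<^bsub>K\<^esub> u) \<odot>\<^bsub>A\<^esub> ?A1"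
    using u' by (simp add: smult_assoc2 smult_assoc1)
  also have "\<dots> = ?A1" using u by simp
  finally show "[m] \<cdot>\<^bsub>A\<^esub> ?A1 \<in> Units A"
    unfolding m_eq Units_def using u' by (auto simp: m_comm intro!: bexI[of _ "inv\<^bsub>K\<^esub> u \<odot>\<^bsub>A\<^esub> ?A1"])
qed

theorem corollary5p2:
  fixes K :: "('k, 'm) ring_scheme" and dK :: "'k \<Rightarrow> 'k"
    and A :: "('k, 'a, 'n) module_scheme" and dA :: "'a \<Rightarrow> 'a"
    and n H :: nat and h :: "nat \<Rightarrow> nat" and I :: "nat \<Rightarrow> 'a set"
  assumes "n \<ge> 1"
    and "H = (\<Sum>i=1..n. h i)"
    and "differential_field K dK"
    and "characteristic_zero K"
    and "differential_algebra K dK A dA"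
    and "\<And>i. i \<in> {1..n} \<Longrightarrow> ideal (I i) A"
  shows "(\<Otimes>\<^bsub>ideals_set A\<^esub>i\<in>{1..n}. deriv_ideal A dA (I i) (h i))
           [^]\<^bsub>ideals_set A\<^esub> (Max ((\<lambda>i. (h i + 1) * (H - h i)) ` {1..n}) + 1)
         \<subseteq> deriv_ideal A dA (\<Otimes>\<^bsub>ideals_set A\<^esub>i\<in>{1..n}. I i) H"
proof -
  interpret rational_differential_ring A dA
    using assms(4,5) by (rule differential_algebra.rational_if_characteristic_zero[rotated])
  show ?thesis
  proof (rule pow_finprod_deriv_ideal_subset)
    \<comment> \<open>The added one turns the bound by the maximum into the strict inequality that
      the straightening requires.\<close>
    show "(h i + 1) * (H - h i) < Max ((\<lambda>i. (h i + 1) * (H - h i)) ` {1..n}) + 1"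
      if "i \<in> {1..n}" for i
      using that by (auto simp: less_Suc_eq_le intro!: Max_ge)
  qed (use assms in auto)
qed

end
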